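(* Let $X=\{x_1,\dots,x_n\}\subset\mathbb{R}^p$ be in general position about $t$, let $n>p(p-1)$, and let $u$ satisfy the conditions listed in the context, with $K=\sup_{s>0}su(s)>p$. Fix $m\ge1$ and put $\epsilon_m=m/(n+m)$. For $k=1,2,\dots$ let $Z_k=X\cup Y_k$, where $Y_k=\{x_1+w_{1,k},x_1+w_{2,k},\dots,x_1+w_{m,k}\}$ with $w_{i,k}\in\mathbb{R}^p$ and $w_{i,k}\to0$ as $k\to\infty$ for each $1\le i\le m$, and suppose that $V_{n+m}(Z_k)$ exists for all $k$. If $$1-\frac{n(p-1)}{K(n-1)}<\epsilon_m<1-\frac{n(p-2)}{K(n-2)},$$ then $\inf_k (x_1-t)'V_{n+m}(Z_k)(x_1-t)>0$, and for any $a\in\mathbb{R}^p$ such that $a'(x_1-t)=0$, $a'V_{n+m}(Z_k)a\to0$ as $k\to\infty$.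
   Context: Fix a dimension $p$, a center $t\in\mathbb{R}^p$ and a function $u:[0,\infty)\to\mathbb{R}$. Put $\psi(s)=su(s)$ and $K=\sup_{s>0}\psi(s)$. Conditions on $u$: (i) $u(s)$ is non-negative, non-increasing and continuous for $s>0$; (ii) $u(s)$ and $su(s)$ are bounded; (iii) $\psi$ is non-decreasing on $s>0$ and strictly increasing on $\{s>0:\psi(s)<K\}$; (iv) $K>p$. For a finite collection (multiset) $Z=\{z_1,\dots,z_N\}$ of points of $\mathbb{R}^p$, the $M$-estimate of scatter $V_N(Z)$ about $t$ is a symmetric positive definite matrix $V$ satisfying $$V=\frac1N\sum_{i=1}^N u(s_i)(z_i-t)(z_i-t)',\qquad s_i=(z_i-t)'V^{-1}(z_i-t).$$ We say $V_N(Z)$ exists if such a $V$ exists. $X$ is in general position about $t$ if for every $p$ of the points, the vectors $x_i-t$ span $\mathbb{R}^p$. Unions of collections are multiset unions, so $Z_k$ has $n+m$ points. Under the assumptions on $X$, $V_{n+m}(X\cup Y)$ is unique whenever it exists. *)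

theory Defs
  imports "HOL-Analysis.Analysis" "HOL-Library.Multiset"
begin

definition psi :: "(real \<Rightarrow> real) \<Rightarrow> real \<Rightarrow> real" where
  "psi u s = s * u s"

definition psi_sup :: "(real \<Rightarrow> real) \<Rightarrow> real" where
  "psi_sup u = (SUP s\<in>{0<..}. psi u s)"

text \<open>The function \<open>u\<close> lives on \<open>[0,\<infinity>)\<close>; its values at negative arguments are irrelevant.\<close>

definition weight_conditions :: "nat \<Rightarrow> (real \<Rightarrow> real) \<Rightarrow> bool" where
  "weight_conditions p u \<longleftrightarrow>
     (\<forall>s>0. 0 \<le> u s) \<and> antimono_on {0<..} u \<and> continuous_on {0<..} u \<and>
     bounded (u ` {0..}) \<and> bounded (psi u ` {0..}) \<and>
     mono_on {0<..} (psi u) \<and> strict_mono_on {s. 0 < s \<and> psi u s < psi_sup u} (psi u) \<and>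
     psi_sup u > real p"

definition sym_pos_def :: "real^'p^'p \<Rightarrow> bool" where
  "sym_pos_def V \<longleftrightarrow> transpose V = V \<and> (\<forall>v. v \<noteq> 0 \<longrightarrow> v \<bullet> (V *v v) > 0)"

definition outer :: "real^'p \<Rightarrow> real^'p^'p" where
  "outer v = (\<chi> i j. v $ i * v $ j)"

definition sq_dist :: "real^'p \<Rightarrow> real^'p^'p \<Rightarrow> real^'p \<Rightarrow> real" where
  "sq_dist t V z = (z - t) \<bullet> (matrix_inv V *v (z - t))"

text \<open>\<open>V\<close> is an \<open>M\<close>-estimate of scatter about \<open>t\<close> for the collection \<open>Z\<close>. Its existence is
  \<open>\<exists>V. is_M_scatter u t Z V\<close>.\<close>

definition is_M_scatter ::
    "(real \<Rightarrow> real) \<Rightarrow> real^'p \<Rightarrow> (real^'p) multiset \<Rightarrow> real^'p^'p \<Rightarrow> bool" where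
  "is_M_scatter u t Z V \<longleftrightarrow> sym_pos_def V \<and>
     V = (1 / real (size Z)) *\<^sub>R (\<Sum>z\<in>#Z. u (sq_dist t V z) *\<^sub>R outer (z - t))"

definition general_position :: "real^'p \<Rightarrow> (real^'p) multiset \<Rightarrow> bool" where
  "general_position t X \<longleftrightarrow>
     (\<forall>A. A \<subseteq># X \<and> size A = CARD('p) \<longrightarrow> span ((\<lambda>x. x - t) ` set_mset A) = UNIV)"

definition collection :: "nat \<Rightarrow> (nat \<Rightarrow> 'a) \<Rightarrow> 'a multiset" where
  "collection N z = {# z i. i \<in># mset_set {1..N} #}"

end

theory Submission
  imports Defs
begin

text \<open>The matrices \<open>V k\<close> are bounded, so it suffices to treat a subsequential limit \<open>W0\<close> and to
  show that its range \<open>R\<close> is the line through \<open>x 1 - t\<close>. Put \<open>N = n + m\<close> and \<open>r = dim R\<close>. The trace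
  of the defining equation gives \<open>\<Sum> \<psi>(s\<^sub>i) = N p\<close>, and restricting that equation to \<open>R\<close> shows that
  the points with limit in \<open>R\<close> account for at least \<open>N r\<close> of this sum asymptotically. Points with
  limit outside \<open>R\<close> have \<open>s\<^sub>i \<longrightarrow> \<infinity>\<close> and contribute \<open>K\<close> each, whence
  \<open>K #{i. z\<^sub>i \<notin> R} \<le> N (p - r)\<close>. By general position at most \<open>r\<close> points of \<open>X\<close> lie in a proper \<open>R\<close>;
  together with \<open>K > p\<close> and the upper bound on \<open>\<epsilon>\<close> this leaves only \<open>R = span {x 1 - t}\<close> or
  \<open>r = p\<close>. If \<open>r = p\<close>, restricting to the hyperplane orthogonal to \<open>x 1 - t\<close>, to which only
  \<open>n - 1\<close> points contribute, gives \<open>N (p - 1) \<le> K (n - 1)\<close>, against the lower bound.\<close>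

subsection \<open>Positive definite forms\<close>

lemma symmetric_form_commute:
  fixes V :: "real^'p^'p"
  assumes "transpose V = V"
  shows "a \<bullet> (V *v b) = b \<bullet> (V *v a)"
  by (metis assms dot_lmul_matrix inner_commute transpose_matrix_vector)

text \<open>Definiteness makes \<open>V\<close> injective, hence invertible. Writing
  \<open>z\<close> as \<open>V\<close> applied to \<open>matrix_inv V *v z\<close> turns
  \<open>z \<bullet> (matrix_inv V *v z)\<close> into a form in \<open>V\<close> itself.\<close>

lemma sym_pos_def_cancel_inv:
  fixes V :: "real^'p^'p"
  assumes "sym_pos_def V"
  shows "V *v (matrix_inv V *v z) = z"
proof -
  have "inj ((*v) V)"
  proof (rule injI)
    fix a b assume "V *v a = V *v b"
    then have "V *v (a - b) = 0" by (simp add: matrix_vector_mult_diff_distrib)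
    then have "(a - b) \<bullet> (V *v (a - b)) = 0" by simp
    then show "a = b" using assms unfolding sym_pos_def_def
      by (metis eq_iff_diff_eq_0 less_irrefl)
  qed
  then have "invertible V"
    using matrix_left_invertible_injective invertible_left_inverse by metis
  then have "V ** matrix_inv V = mat 1"
    unfolding invertible_def matrix_inv_def by (rule someI2_ex) blast
  then show ?thesis by (simp add: matrix_vector_mul_assoc)
qed

lemma inner_outer: "a \<bullet> (outer z *v b) = (a \<bullet> z) * (b \<bullet> z)"
proof -
  have "outer z *v b = (b \<bullet> z) *\<^sub>R z"
    by (simp add: vec_eq_iff outer_def matrix_vector_mult_def inner_vec_def sum_distrib_right
        sum_distrib_left mult.commute mult.left_commute)
  then show ?thesis by simp
qed

text \<open>Orthonormality for the inner product \<open>a \<bullet> (V *v b)\<close>. Such systems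
  take the place of a square root of \<open>V\<close>.\<close>

definition form_orthonormal :: "real^'p^'p \<Rightarrow> (real^'p) set \<Rightarrow> bool" where
  "form_orthonormal V B \<longleftrightarrow>
     finite B \<and> (\<forall>b\<in>B. \<forall>c\<in>B. b \<bullet> (V *v c) = (if b = c then 1 else 0))"

lemma form_orthonormal_projection:
  assumes B: "form_orthonormal V B" and "b \<in> B"
  shows "b \<bullet> (V *v (\<Sum>c\<in>B. g c *\<^sub>R c)) = g b"
proof -
  have "b \<bullet> (V *v (\<Sum>c\<in>B. g c *\<^sub>R c)) = (\<Sum>c\<in>B. g c * (b \<bullet> (V *v c)))"
    by (simp add: linear_sum[OF matrix_vector_mul_linear] matrix_vector_mult_scaleR inner_sum_right)
  also have "\<dots> = (\<Sum>c\<in>B. if b = c then g c else 0)"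
    using assms by (intro sum.cong) (auto simp: form_orthonormal_def)
  finally show ?thesis using assms by (simp add: form_orthonormal_def)
qed

text \<open>Gram-Schmidt: \<open>r v\<close> is what the projection of \<open>v\<close> along
  \<open>B\<close> leaves over, so the two facts are Pythagoras and orthogonality of the
  residual.\<close>

lemma form_orthonormal_residual:
  fixes V :: "real^'p^'p"
  assumes V: "transpose V = V" and B: "form_orthonormal V B"
  defines "r \<equiv> \<lambda>v. v - (\<Sum>b\<in>B. (b \<bullet> (V *v v)) *\<^sub>R b)"
  shows "r v \<bullet> (V *v r v) = v \<bullet> (V *v v) - (\<Sum>b\<in>B. (b \<bullet> (V *v v))\<^sup>2)"
    and "b \<in> B \<Longrightarrow> b \<bullet> (V *v r v) = 0"
proof -
  define P where "P = (\<Sum>b\<in>B. (b \<bullet> (V *v v)) *\<^sub>R b)"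
  have bP: "b \<bullet> (V *v P) = b \<bullet> (V *v v)" if "b \<in> B" for b
    unfolding P_def using form_orthonormal_projection[OF B that] .
  have r: "r v = v - P" by (simp add: r_def P_def)
  show "b \<bullet> (V *v r v) = 0" if "b \<in> B"
    using bP[OF that] by (simp add: r matrix_vector_mult_diff_distrib inner_diff_right)
  have Pa: "P \<bullet> a = (\<Sum>b\<in>B. (b \<bullet> (V *v v)) * (b \<bullet> a))" for a
    by (simp add: P_def inner_sum_left)
  have "P \<bullet> (V *v P) = (\<Sum>b\<in>B. (b \<bullet> (V *v v))\<^sup>2)"
    unfolding Pa by (intro sum.cong) (auto simp: bP power2_eq_square)
  moreover have "P \<bullet> (V *v v) = (\<Sum>b\<in>B. (b \<bullet> (V *v v))\<^sup>2)"
    unfolding Pa by (simp add: power2_eq_square)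
  moreover have "v \<bullet> (V *v P) = P \<bullet> (V *v v)"
    by (rule symmetric_form_commute[OF V])
  ultimately show "r v \<bullet> (V *v r v) = v \<bullet> (V *v v) - (\<Sum>b\<in>B. (b \<bullet> (V *v v))\<^sup>2)"
    by (simp add: r matrix_vector_mult_diff_distrib inner_diff_right inner_diff_left)
qed

lemma sym_pos_def_nonneg: "sym_pos_def V \<Longrightarrow> 0 \<le> v \<bullet> (V *v v)"
  by (cases "v = 0") (auto simp: sym_pos_def_def less_imp_le)

text \<open>By Pythagoras the difference of the two sides is the form of the residual.\<close>

lemma form_Bessel:
  fixes V :: "real^'p^'p"
  assumes V: "sym_pos_def V" and B: "form_orthonormal V B"
  shows "(\<Sum>b\<in>B. (b \<bullet> (V *v v))\<^sup>2) \<le> v \<bullet> (V *v v)"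
proof -
  have "transpose V = V" using V by (simp add: sym_pos_def_def)
  note r = form_orthonormal_residual(1)[OF this B, of v]
  have "0 \<le> v \<bullet> (V *v v) - (\<Sum>b\<in>B. (b \<bullet> (V *v v))\<^sup>2)"
    unfolding r[symmetric] by (rule sym_pos_def_nonneg[OF V])
  then show ?thesis by simp
qed

lemma form_Cauchy_Schwarz:
  fixes V :: "real^'p^'p"
  assumes V: "sym_pos_def V"
  shows "(a \<bullet> (V *v v))\<^sup>2 \<le> (a \<bullet> (V *v a)) * (v \<bullet> (V *v v))"
proof (cases "a = 0")
  case False
  define c where "c = a \<bullet> (V *v a)"
  have c: "c > 0" using V False by (simp add: c_def sym_pos_def_def)
  \<comment> \<open>Bessel's inequality for the single normalised vector \<open>e\<close> is
    Cauchy-Schwarz.\<close>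
  define e where "e = (1 / sqrt c) *\<^sub>R a"
  have "form_orthonormal V {e}"
    using c by (simp add: form_orthonormal_def e_def matrix_vector_mult_scaleR flip: c_def)
  from form_Bessel[OF V this, of v] have "(a \<bullet> (V *v v))\<^sup>2 / c \<le> v \<bullet> (V *v v)"
    using c by (simp add: e_def power_divide)
  then show ?thesis using c by (simp add: divide_le_eq mult.commute flip: c_def)
qed simp

lemma form_orthonormal_independent:
  assumes B: "form_orthonormal V B"
  shows "independent B"
proof -
  have fin: "finite B" using B by (simp add: form_orthonormal_def)
  show ?thesis
    unfolding independent_explicit_module
  proof (intro allI impI)
    fix T g v assume T: "finite T" "T \<subseteq> B" "(\<Sum>v\<in>T. g v *\<^sub>R v) = 0" "v \<in> T"
    have "form_orthonormal V T" using B T by (auto simp: form_orthonormal_def subset_iff)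
    from form_orthonormal_projection[OF this \<open>v \<in> T\<close>, of g] show "g v = 0"
      using T by simp
  qed
qed

text \<open>Orthonormal systems in \<open>S\<close> are independent, so one of greatest cardinality
  exists. It spans \<open>S\<close>, since a nonzero residual could be normalised and added. The
  last clause is Parseval's identity.\<close>

lemma form_orthonormal_basis:
  fixes V :: "real^'p^'p"
  assumes V: "sym_pos_def V" and S: "subspace S"
  obtains B where "form_orthonormal V B" "B \<subseteq> S" "card B = dim S"
    "\<And>v. v \<in> S \<Longrightarrow> v \<bullet> (V *v v) = (\<Sum>b\<in>B. (b \<bullet> (V *v v))\<^sup>2)"
proof -
  have sym: "transpose V = V" using V by (simp add: sym_pos_def_def)
  define Q where "Q B \<longleftrightarrow> form_orthonormal V B \<and> B \<subseteq> S" for B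
  have bound: "card B \<le> dim S" if "Q B" for B
    using that form_orthonormal_independent independent_card_le_dim unfolding Q_def by blast
  have "Q {}" by (simp add: Q_def form_orthonormal_def)
  then obtain B where B: "Q B" and max: "\<And>C. Q C \<Longrightarrow> card C \<le> card B"
    using ex_has_greatest_nat[of Q "{}" card "Suc (dim S)"] bound by (metis less_Suc_eq_le)
  have ortho: "form_orthonormal V B" and BS: "B \<subseteq> S" and fin: "finite B"
    using B by (auto simp: Q_def form_orthonormal_def)
  have residual: "v = (\<Sum>b\<in>B. (b \<bullet> (V *v v)) *\<^sub>R b)" if "v \<in> S" for v
  proof (rule ccontr)
    define r where "r = v - (\<Sum>b\<in>B. (b \<bullet> (V *v v)) *\<^sub>R b)"
    assume "v \<noteq> (\<Sum>b\<in>B. (b \<bullet> (V *v v)) *\<^sub>R b)"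
    then have "r \<noteq> 0" by (simp add: r_def)
    then have pos: "r \<bullet> (V *v r) > 0" using V by (simp add: sym_pos_def_def)
    define e where "e = (1 / sqrt (r \<bullet> (V *v r))) *\<^sub>R r"
    have ee: "e \<bullet> (V *v e) = 1"
      using pos by (simp add: e_def matrix_vector_mult_scaleR)
    have rS: "r \<in> S" unfolding r_def
      using S that BS by (intro subspace_diff subspace_sum subspace_scale) auto
    then have eS: "e \<in> S" unfolding e_def using S by (simp add: subspace_scale)
    have be: "b \<bullet> (V *v e) = 0" "e \<bullet> (V *v b) = 0" if "b \<in> B" for b
    proof -
      show "b \<bullet> (V *v e) = 0"
        using form_orthonormal_residual(2)[OF sym ortho that, of v]
        by (simp add: e_def r_def matrix_vector_mult_scaleR)
      then show "e \<bullet> (V *v b) = 0" using symmetric_form_commute[OF sym] by metis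
    qed
    then have "e \<notin> B" using ee by force
    moreover have "form_orthonormal V (insert e B)"
      using ortho ee be \<open>e \<notin> B\<close> by (auto simp: form_orthonormal_def)
    ultimately show False
      using max[of "insert e B"] eS BS fin by (simp add: Q_def)
  qed
  have "v \<in> span B" if "v \<in> S" for v
    by (subst residual[OF that]) (intro span_sum span_scale span_base)
  then have "S \<subseteq> span B" by blast
  then have "card B = dim S"
    using basis_card_eq_dim[OF BS _ form_orthonormal_independent[OF ortho]] by blast
  moreover have "v \<bullet> (V *v v) = (\<Sum>b\<in>B. (b \<bullet> (V *v v))\<^sup>2)" if "v \<in> S" for v
    using form_orthonormal_residual(1)[OF sym ortho, of v] residual[OF that] by simp
  ultimately show thesis using that ortho BS by blast
qed

subsection \<open>Limits of weights and forms\<close>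

lemma psi_le_psi_sup:
  assumes u: "weight_conditions p u" and s: "0 \<le> s"
  shows "psi u s \<le> psi_sup u"
proof (cases "s = 0")
  case True
  \<comment> \<open>The supremum runs over positive arguments only; at 0, \<open>psi u\<close>
    vanishes while \<open>psi_sup u\<close> exceeds \<open>real p\<close>.\<close>
  then show ?thesis using u by (simp add: psi_def weight_conditions_def)
next
  case False
  have "bounded (psi u ` {0<..})"
    using u unfolding weight_conditions_def
    by (meson bounded_subset image_mono Ioi_le_Ico)
  then have "bdd_above (psi u ` {0<..})" by (rule bounded_imp_bdd_above)
  then show ?thesis unfolding psi_sup_def using s False by (intro cSUP_upper) auto
qed

lemma psi_tendsto_psi_sup:
  assumes u: "weight_conditions p u"
  shows "(psi u \<longlongrightarrow> psi_sup u) at_top"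
proof (rule tendstoI)
  fix e :: real assume "e > 0"
  then have "psi_sup u - e < (SUP s\<in>{0<..}. psi u s)" by (simp add: psi_sup_def)
  moreover have "{0::real<..} \<noteq> {}" by (metis greaterThan_iff empty_iff zero_less_one)
  ultimately obtain s0 where s0: "s0 > 0" "psi_sup u - e < psi u s0"
    using less_cSUP_iff[of "{0<..}" "psi u"] psi_le_psi_sup[OF u]
    by (metis (no_types, lifting) bdd_aboveI2 greaterThan_iff less_imp_le)
  show "\<forall>\<^sub>F s in at_top. dist (psi u s) (psi_sup u) < e"
    using eventually_ge_at_top[of s0]
  proof eventually_elim
    case (elim s)
    then have "psi u s0 \<le> psi u s"
      using u s0 unfolding weight_conditions_def by (auto intro: mono_onD)
    then show ?case using s0 elim psi_le_psi_sup[OF u, of s] by (simp add: dist_real_def)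
  qed
qed

text \<open>Points at diverging distance lose all their weight, although their \<open>psi\<close>
  value tends to \<open>psi_sup u\<close>.\<close>

lemma weight_tendsto_zero:
  assumes u: "weight_conditions p u"
  shows "(u \<longlongrightarrow> 0) at_top"
proof (rule Lim_transform_eventually)
  show "((\<lambda>s. psi u s / s) \<longlongrightarrow> 0) at_top"
    by (rule real_tendsto_divide_at_top[OF psi_tendsto_psi_sup[OF u] filterlim_ident])
  show "\<forall>\<^sub>F s in at_top. psi u s / s = u s"
    using eventually_gt_at_top[of 0] by eventually_elim (simp add: psi_def)
qed

section \<open>Convergence and uniform positivity of quadratic forms\<close>

lemma linear_form: "linear (\<lambda>A :: real^'p^'p. a \<bullet> (A *v b))"
  by (rule linearI)
    (simp_all add: matrix_vector_mult_add_rdistrib inner_add_right flip: scaleR_matrix_vector_assoc)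

lemma tendsto_form:
  fixes W :: "'a \<Rightarrow> real^'p^'p"
  assumes "(W \<longlongrightarrow> W0) F"
  shows "((\<lambda>k. a \<bullet> (W k *v b)) \<longlongrightarrow> a \<bullet> (W0 *v b)) F"
  using bounded_linear.tendsto[OF linear_form[THEN linear_conv_bounded_linear[THEN iffD1]] assms] .

text \<open>The limit \<open>W0\<close> may be singular, but on a subspace where it is definite,
  compactness of the unit sphere gives a lower bound that passes to all late
  \<open>W k\<close>.\<close>

lemma eventually_form_ge:
  fixes W :: "nat \<Rightarrow> real^'p^'p"
  assumes W: "W \<longlonglongrightarrow> W0" and S: "subspace S"
    and pos: "\<And>v. v \<in> S \<Longrightarrow> v \<noteq> 0 \<Longrightarrow> v \<bullet> (W0 *v v) > 0"
  obtains \<delta> where "\<delta> > 0"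
    "\<forall>\<^sub>F k in sequentially. \<forall>v\<in>S. \<delta> * (norm v)\<^sup>2 \<le> v \<bullet> (W k *v v)"
proof -
  \<comment> \<open>The factor 2 leaves one \<open>\<delta>\<close> to be spent on the perturbation
    \<open>W k - W0\<close>.\<close>
  have "\<exists>\<delta>>0. \<forall>v\<in>S. 2 * \<delta> * (norm v)\<^sup>2 \<le> v \<bullet> (W0 *v v)"
  proof (cases "S \<inter> sphere 0 1 = {}")
    case True
    have "v = 0" if "v \<in> S" for v
    proof (rule ccontr)
      assume "v \<noteq> 0"
      then have "(1 / norm v) *\<^sub>R v \<in> S \<inter> sphere 0 1"
        using that S by (simp add: subspace_scale)
      with True show False by blast
    qed
    then have "\<forall>v\<in>S. 2 * 1 * (norm v)\<^sup>2 \<le> v \<bullet> (W0 *v v)" by force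
    then show ?thesis using zero_less_one by blast
  next
    case False
    have "compact (S \<inter> sphere 0 1)"
      using closed_subspace[OF S] by (simp add: closed_Int_compact)
    moreover have "continuous_on (S \<inter> sphere 0 1) (\<lambda>v. v \<bullet> (W0 *v v))"
      by (intro continuous_intros matrix_vector_mult_linear_continuous_on)
    ultimately obtain v0 where v0: "v0 \<in> S \<inter> sphere 0 1"
      "\<And>v. v \<in> S \<inter> sphere 0 1 \<Longrightarrow> v0 \<bullet> (W0 *v v0) \<le> v \<bullet> (W0 *v v)"
      using continuous_attains_inf[OF _ False] by blast
    define c where "c = v0 \<bullet> (W0 *v v0)"
    have "v0 \<noteq> 0" using v0(1) by auto
    then have "c > 0" using pos v0(1) by (auto simp: c_def)
    moreover have "c * (norm v)\<^sup>2 \<le> v \<bullet> (W0 *v v)" if "v \<in> S" for v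
    proof (cases "v = 0")
      case False
      then have "(1 / norm v) *\<^sub>R v \<in> S \<inter> sphere 0 1"
        using that S by (simp add: subspace_scale)
      from v0(2)[OF this] have "c \<le> v \<bullet> (W0 *v v) / (norm v)\<^sup>2"
        by (simp add: c_def matrix_vector_mult_scaleR power2_eq_square)
      then show ?thesis using False by (simp add: pos_le_divide_eq)
    qed simp
    ultimately show ?thesis by (intro exI[of _ "c/2"]) auto
  qed
  then obtain \<delta> where \<delta>: "\<delta> > 0" "\<And>v. v \<in> S \<Longrightarrow> 2 * \<delta> * (norm v)\<^sup>2 \<le> v \<bullet> (W0 *v v)" by blast
  \<comment> \<open>The sum of absolute entries dominates the operator norm, so entrywise
    convergence controls the forms uniformly in \<open>v\<close>.\<close>
  define E where "E k = (\<Sum>i\<in>UNIV. \<Sum>j\<in>UNIV. \<bar>(W k - W0) $ i $ j\<bar>)" for k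
  have "E \<longlonglongrightarrow> (\<Sum>i\<in>UNIV. \<Sum>j\<in>UNIV. \<bar>(W0 - W0) $ i $ j\<bar>)"
    unfolding E_def by (intro tendsto_intros W)
  then have "E \<longlonglongrightarrow> 0" by simp
  then have "\<forall>\<^sub>F k in sequentially. E k < \<delta>" using \<delta>(1) by (rule order_tendstoD)
  then have "\<forall>\<^sub>F k in sequentially. \<forall>v\<in>S. \<delta> * (norm v)\<^sup>2 \<le> v \<bullet> (W k *v v)"
  proof eventually_elim
    case (elim k)
    show ?case
    proof
      fix v assume v: "v \<in> S"
      have "norm ((W k - W0) *v v) \<le> onorm ((*v) (W k - W0)) * norm v"
        by (rule onorm) (simp add: matrix_vector_mul_bounded_linear)
      also have "\<dots> \<le> \<delta> * norm v"
        using onorm_le_matrix_component_sum[of "W k - W0"] elim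
        by (intro mult_right_mono) (simp_all add: E_def)
      finally have "\<bar>v \<bullet> ((W k - W0) *v v)\<bar> \<le> norm v * (\<delta> * norm v)"
        using Cauchy_Schwarz_ineq2[of v "(W k - W0) *v v"]
        by (meson mult_left_mono norm_ge_zero order_trans)
      then have "\<bar>v \<bullet> (W k *v v) - v \<bullet> (W0 *v v)\<bar> \<le> \<delta> * (norm v)\<^sup>2"
        by (simp add: matrix_vector_mult_diff_rdistrib inner_diff_right power2_eq_square mult_ac)
      then show "\<delta> * (norm v)\<^sup>2 \<le> v \<bullet> (W k *v v)" using \<delta>(2)[OF v] by linarith
    qed
  qed
  then show thesis using that \<delta>(1) by blast
qed

subsection \<open>Limits of M-estimates\<close>

text \<open>A convergent sequence of scatter estimates for convergent, already centred points.
  Indexing by \<open>I\<close> counts repeated points separately; positive definiteness is assumed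
  of each \<open>W k\<close> but not of \<open>W0\<close>.\<close>

locale scatter_limit =
  fixes u :: "real \<Rightarrow> real" and I :: "'i set" and z :: "'i \<Rightarrow> nat \<Rightarrow> real^'p"
    and z0 :: "'i \<Rightarrow> real^'p" and W :: "nat \<Rightarrow> real^'p^'p" and W0 :: "real^'p^'p"
  assumes u: "weight_conditions CARD('p) u" and finite_I: "finite I" and I_nonempty: "I \<noteq> {}"
    and z: "\<And>i. i \<in> I \<Longrightarrow> z i \<longlonglongrightarrow> z0 i"
    and W_pos_def: "\<And>k. sym_pos_def (W k)" and W: "W \<longlonglongrightarrow> W0"
    and W_eq: "\<And>k. W k = (1 / real (card I)) *\<^sub>R
      (\<Sum>i\<in>I. u (z i k \<bullet> (matrix_inv (W k) *v z i k)) *\<^sub>R outer (z i k))"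
begin

section \<open>Squared distances and the trace identity\<close>

definition s :: "'i \<Rightarrow> nat \<Rightarrow> real" where
  "s i k = z i k \<bullet> (matrix_inv (W k) *v z i k)"

lemma inner_z: "a \<bullet> (W k *v (matrix_inv (W k) *v z i k)) = a \<bullet> z i k"
  by (simp add: sym_pos_def_cancel_inv[OF W_pos_def])

lemma s_eq: "(matrix_inv (W k) *v z i k) \<bullet> z i k = s i k"
  unfolding s_def by (rule inner_commute)

lemma s_nonneg: "0 \<le> s i k"
  using sym_pos_def_nonneg[OF W_pos_def, of "matrix_inv (W k) *v z i k" k] unfolding inner_z s_eq .

lemma form_W:
  "real (card I) * (b \<bullet> (W k *v b)) = (\<Sum>i\<in>I. u (s i k) * (b \<bullet> z i k)\<^sup>2)"
proof -
  have "card I \<noteq> 0" using finite_I I_nonempty by simp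
  then show ?thesis
    by (subst W_eq)
      (simp add: s_def linear_cmul[OF linear_form] linear_sum[OF linear_form] inner_outer power2_eq_square)
qed

text \<open>Apply the defining equation as a form to each \<open>b\<close> in \<open>B\<close>,
  where the left side is 1, and add up. For a basis of a subspace this is the trace of the equation
  restricted to it.\<close>

lemma trace_eq:
  assumes B: "form_orthonormal (W k) B"
  shows "real (card I) * real (card B) = (\<Sum>i\<in>I. u (s i k) * (\<Sum>b\<in>B. (b \<bullet> z i k)\<^sup>2))"
proof -
  have "real (card I) * real (card B) = (\<Sum>b\<in>B. real (card I) * (b \<bullet> (W k *v b)))"
    using B by (simp add: form_orthonormal_def)
  also have "\<dots> = (\<Sum>i\<in>I. u (s i k) * (\<Sum>b\<in>B. (b \<bullet> z i k)\<^sup>2))"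
    unfolding form_W by (subst sum.swap) (simp add: sum_distrib_left)
  finally show ?thesis .
qed

text \<open>For a basis of the whole space, Parseval at \<open>matrix_inv (W k) *v z i k\<close>
  turns the inner sums of \<open>trace_eq\<close> into \<open>s i k\<close>.\<close>

lemma sum_psi: "(\<Sum>i\<in>I. psi u (s i k)) = real (card I) * real CARD('p)"
proof -
  obtain B where B: "form_orthonormal (W k) B" "card B = dim (UNIV :: (real^'p) set)"
    "\<And>v. v \<bullet> (W k *v v) = (\<Sum>b\<in>B. (b \<bullet> (W k *v v))\<^sup>2)"
    using form_orthonormal_basis[OF W_pos_def subspace_UNIV] by (metis UNIV_I)
  have "s i k = (\<Sum>b\<in>B. (b \<bullet> z i k)\<^sup>2)" for i
    using B(3)[of "matrix_inv (W k) *v z i k"] unfolding inner_z s_eq .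
  then show ?thesis
    using trace_eq[OF B(1)] B(2) by (simp add: psi_def mult.commute)
qed

text \<open>A \<open>W k\<close>-orthonormal basis \<open>B k\<close> of \<open>S\<close> stays bounded because \<open>W0\<close> is positive definite
  on \<open>S\<close>. So the contribution of point \<open>i\<close> to the trace identity vanishes in the limit when
  \<open>z0 i\<close> is orthogonal to \<open>S\<close>, and also when \<open>s i\<close> diverges, for then its weight tends to 0.\<close>

lemma dim_le_sum_psi:
  assumes S: "subspace S" and pos: "\<And>v. v \<in> S \<Longrightarrow> v \<noteq> 0 \<Longrightarrow> v \<bullet> (W0 *v v) > 0"
    and J: "J \<subseteq> I"
    and negligible: "\<And>i. i \<in> I - J \<Longrightarrow>
      (\<forall>v\<in>S. v \<bullet> z0 i = 0) \<or> filterlim (s i) at_top sequentially"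
    and e: "e > 0"
  shows "\<forall>\<^sub>F k in sequentially. real (card I) * real (dim S) \<le> (\<Sum>i\<in>J. psi u (s i k)) + e"
proof -
  have "\<exists>B. form_orthonormal (W k) B \<and> B \<subseteq> S \<and> card B = dim S" for k
    using form_orthonormal_basis[OF W_pos_def S] by metis
  then obtain B where B: "\<And>k. form_orthonormal (W k) (B k)" "\<And>k. B k \<subseteq> S"
    "\<And>k. card (B k) = dim S" by metis
  define q where "q i k = (\<Sum>b\<in>B k. (b \<bullet> z i k)\<^sup>2)" for i k
  obtain \<delta> where \<delta>: "\<delta> > 0"
    "\<forall>\<^sub>F k in sequentially. \<forall>v\<in>S. \<delta> * (norm v)\<^sup>2 \<le> v \<bullet> (W k *v v)"
    using eventually_form_ge[OF W S pos] by blast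
  \<comment> \<open>Each \<open>b\<close> has form value 1, which is at least
    \<open>\<delta>\<close> times its squared norm; hence that norm is at most
    \<open>1 / \<delta>\<close>.\<close>
  have bound: "\<forall>\<^sub>F k in sequentially. \<forall>y. (\<Sum>b\<in>B k. (b \<bullet> y)\<^sup>2) \<le> real (dim S) / \<delta> * (norm y)\<^sup>2"
    using \<delta>(2)
  proof eventually_elim
    case (elim k)
    show ?case
    proof
      fix y
      have "(b \<bullet> y)\<^sup>2 \<le> 1 / \<delta> * (norm y)\<^sup>2" if "b \<in> B k" for b
      proof -
        have "\<delta> * (norm b)\<^sup>2 \<le> b \<bullet> (W k *v b)" using elim that B(2) by blast
        also have "\<dots> = 1" using B(1) that by (simp add: form_orthonormal_def)
        finally have "(norm b)\<^sup>2 \<le> 1 / \<delta>" using \<delta>(1) by (simp add: field_simps)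
        moreover have "(b \<bullet> y)\<^sup>2 \<le> (norm b)\<^sup>2 * (norm y)\<^sup>2"
          using Cauchy_Schwarz_ineq[of b y] by (simp add: power2_norm_eq_inner)
        ultimately show ?thesis
          by (meson mult_right_mono order_trans zero_le_power2)
      qed
      then show "(\<Sum>b\<in>B k. (b \<bullet> y)\<^sup>2) \<le> real (dim S) / \<delta> * (norm y)\<^sup>2"
        using sum_bounded_above[of "B k" "\<lambda>b. (b \<bullet> y)\<^sup>2" "1 / \<delta> * (norm y)\<^sup>2"] B(3) by simp
    qed
  qed
  have q_nonneg: "0 \<le> q i k" for i k by (simp add: q_def sum_nonneg)
  have vanish: "(\<lambda>k. u (s i k) * q i k) \<longlonglongrightarrow> 0" if i: "i \<in> I - J" for i
    using negligible[OF i]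
  proof
    assume orth: "\<forall>v\<in>S. v \<bullet> z0 i = 0"
    obtain C where C: "\<And>s. 0 \<le> s \<Longrightarrow> \<bar>u s\<bar> \<le> C"
      using u unfolding weight_conditions_def bounded_iff by auto
    have zi: "z i \<longlonglongrightarrow> z0 i" using z i by blast
    show ?thesis
    proof (rule Lim_null_comparison)
      show "(\<lambda>k. C * (real (dim S) / \<delta> * (norm (z i k - z0 i))\<^sup>2)) \<longlonglongrightarrow> 0"
        by (rule tendsto_eq_intros zi refl | simp)+
      show "\<forall>\<^sub>F k in sequentially. norm (u (s i k) * q i k)
          \<le> C * (real (dim S) / \<delta> * (norm (z i k - z0 i))\<^sup>2)"
        using bound
      proof eventually_elim
        case (elim k)
        \<comment> \<open>Orthogonality of \<open>S\<close> to \<open>z0 i\<close> allows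
          \<open>z i k\<close> to be replaced by its vanishing deviation from the limit.\<close>
        have "q i k = (\<Sum>b\<in>B k. (b \<bullet> (z i k - z0 i))\<^sup>2)"
          unfolding q_def using orth B(2)[of k] by (intro sum.cong) (auto simp: inner_diff_right)
        with elim have "q i k \<le> real (dim S) / \<delta> * (norm (z i k - z0 i))\<^sup>2" by simp
        then have "\<bar>u (s i k)\<bar> * q i k \<le> C * (real (dim S) / \<delta> * (norm (z i k - z0 i))\<^sup>2)"
          using C[OF s_nonneg, of i k] q_nonneg[of i k] by (intro mult_mono) linarith+
        then show ?case using q_nonneg[of i k] by (simp add: abs_mult)
      qed
    qed
  next
    assume "filterlim (s i) at_top sequentially"
    then have u0: "(\<lambda>k. u (s i k)) \<longlonglongrightarrow> 0"
      by (rule filterlim_compose[OF weight_tendsto_zero[OF u]])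
    have zi: "z i \<longlonglongrightarrow> z0 i" using z i by blast
    show ?thesis
    proof (rule Lim_null_comparison)
      show "(\<lambda>k. \<bar>u (s i k)\<bar> * (real (dim S) / \<delta> * (norm (z i k))\<^sup>2)) \<longlonglongrightarrow> 0"
        by (rule tendsto_eq_intros zi u0 refl | simp)+
      show "\<forall>\<^sub>F k in sequentially. norm (u (s i k) * q i k)
          \<le> \<bar>u (s i k)\<bar> * (real (dim S) / \<delta> * (norm (z i k))\<^sup>2)"
        using bound
      proof eventually_elim
        case (elim k)
        then have "\<bar>u (s i k)\<bar> * q i k \<le> \<bar>u (s i k)\<bar> * (real (dim S) / \<delta> * (norm (z i k))\<^sup>2)"
          unfolding q_def by (intro mult_left_mono) auto
        then show ?case using q_nonneg[of i k] by (simp add: abs_mult)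
      qed
    qed
  qed
  have uq: "u (s i k) * q i k \<le> psi u (s i k)" for i k
  proof -
    have qs: "q i k \<le> s i k"
      using form_Bessel[OF W_pos_def B(1), of k "matrix_inv (W k) *v z i k"]
      unfolding inner_z s_eq q_def .
    show ?thesis
    \<comment> \<open>The sign of \<open>u\<close> is known only at positive arguments; at distance
      0 the bound by \<open>s i k\<close> forces \<open>q i k = 0\<close>.\<close>
    proof (cases "s i k = 0")
      case True
      then show ?thesis using qs q_nonneg[of i k] by (simp add: psi_def)
    next
      case False
      then have "0 \<le> u (s i k)"
        using s_nonneg[of i k] u by (simp add: weight_conditions_def)
      then show ?thesis using qs by (simp add: psi_def mult.commute mult_right_mono)
    qed
  qed
  have "(\<lambda>k. \<Sum>i\<in>I - J. u (s i k) * q i k) \<longlonglongrightarrow> 0"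
    using tendsto_sum[of "I - J", OF vanish] by simp
  then have "\<forall>\<^sub>F k in sequentially. (\<Sum>i\<in>I - J. u (s i k) * q i k) < e"
    using e by (rule order_tendstoD)
  then show ?thesis
  proof eventually_elim
    case (elim k)
    have "real (card I) * real (dim S) = (\<Sum>i\<in>I. u (s i k) * q i k)"
      using trace_eq[OF B(1)] B(3) by (simp add: q_def)
    also have "\<dots> = (\<Sum>i\<in>I - J. u (s i k) * q i k) + (\<Sum>i\<in>J. u (s i k) * q i k)"
      using sum.subset_diff[OF J finite_I] by blast
    also have "\<dots> \<le> e + (\<Sum>i\<in>J. psi u (s i k))"
      using elim uq by (intro add_mono sum_mono) auto
    finally show ?case by simp
  qed
qed

text \<open>Points whose limit is orthogonal to \<open>S\<close> contribute nothing asymptotically,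
  and every other point contributes at most \<open>psi_sup u\<close>.\<close>

lemma dim_le_card_off:
  assumes S: "subspace S" and pos: "\<And>v. v \<in> S \<Longrightarrow> v \<noteq> 0 \<Longrightarrow> v \<bullet> (W0 *v v) > 0"
  shows "real (card I) * real (dim S) \<le> psi_sup u * real (card {i \<in> I. \<exists>v\<in>S. v \<bullet> z0 i \<noteq> 0})"
proof (rule field_le_epsilon)
  fix e :: real assume "e > 0"
  define J where "J = {i \<in> I. \<exists>v\<in>S. v \<bullet> z0 i \<noteq> 0}"
  have "\<forall>\<^sub>F k in sequentially. real (card I) * real (dim S) \<le> (\<Sum>i\<in>J. psi u (s i k)) + e"
    by (rule dim_le_sum_psi[OF S pos _ _ \<open>e > 0\<close>]) (auto simp: J_def)
  then obtain k where "real (card I) * real (dim S) \<le> (\<Sum>i\<in>J. psi u (s i k)) + e"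
    using eventually_happens'[OF sequentially_bot] by blast
  moreover have "(\<Sum>i\<in>J. psi u (s i k)) \<le> real (card J) * psi_sup u"
    by (rule sum_bounded_above) (rule psi_le_psi_sup[OF u s_nonneg])
  ultimately show "real (card I) * real (dim S) \<le> psi_sup u * real (card J) + e"
    by (simp add: mult.commute)
qed

section \<open>The limit matrix, its range and the points outside it\<close>

lemma W0_nonneg: "0 \<le> v \<bullet> (W0 *v v)"
  using tendsto_form[OF W] by (rule tendsto_lowerbound) (auto simp: sym_pos_def_nonneg[OF W_pos_def])

lemma W0_commute: "a \<bullet> (W0 *v b) = b \<bullet> (W0 *v a)"
proof -
  have "(\<lambda>k. a \<bullet> (W k *v b)) = (\<lambda>k. b \<bullet> (W k *v a))"
    using W_pos_def symmetric_form_commute unfolding sym_pos_def_def by blast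
  then show ?thesis
    using tendsto_form[OF W, of a b] tendsto_form[OF W, of b a] LIMSEQ_unique by metis
qed

lemma W0_Cauchy_Schwarz: "(a \<bullet> (W0 *v v))\<^sup>2 \<le> (a \<bullet> (W0 *v a)) * (v \<bullet> (W0 *v v))"
proof (rule LIMSEQ_le)
  show "(\<lambda>k. (a \<bullet> (W k *v v))\<^sup>2) \<longlonglongrightarrow> (a \<bullet> (W0 *v v))\<^sup>2"
    by (intro tendsto_intros tendsto_form[OF W])
  show "(\<lambda>k. (a \<bullet> (W k *v a)) * (v \<bullet> (W k *v v))) \<longlonglongrightarrow> (a \<bullet> (W0 *v a)) * (v \<bullet> (W0 *v v))"
    by (intro tendsto_intros tendsto_form[OF W])
qed (use form_Cauchy_Schwarz[OF W_pos_def] in blast)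

text \<open>The range of \<open>W0\<close>, as the orthogonal complement of its kernel.\<close>

definition rng :: "(real^'p) set" where
  "rng = {v. \<forall>a. a \<bullet> (W0 *v a) = 0 \<longrightarrow> a \<bullet> v = 0}"

lemma subspace_rng: "subspace rng"
  unfolding subspace_def rng_def by (auto simp: inner_add_right)

lemma W0_pos_on_rng: "v \<in> rng \<Longrightarrow> v \<noteq> 0 \<Longrightarrow> v \<bullet> (W0 *v v) > 0"
  using W0_nonneg[of v] unfolding rng_def by (metis (mono_tags) inner_eq_zero_iff less_eq_real_def mem_Collect_eq)

lemma W0_in_rng: "W0 *v a \<in> rng"
  unfolding rng_def
proof (intro CollectI allI impI)
  fix b assume "b \<bullet> (W0 *v b) = 0"
  then show "b \<bullet> (W0 *v a) = 0" using W0_Cauchy_Schwarz[of b a] by simp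
qed

text \<open>Some null vector \<open>a\<close> of the limit form is not orthogonal to
  \<open>z0 i\<close>. Cauchy-Schwarz bounds \<open>s i k\<close> below by a quotient whose
  numerator has a positive limit and whose positive denominator tends to 0.\<close>

lemma s_at_top:
  assumes i: "i \<in> I" and "z0 i \<notin> rng"
  shows "filterlim (s i) at_top sequentially"
proof -
  obtain a where a: "a \<bullet> (W0 *v a) = 0" "a \<bullet> z0 i \<noteq> 0"
    using assms by (auto simp: rng_def)
  then have "a \<noteq> 0" by auto
  then have pos: "a \<bullet> (W k *v a) > 0" for k using W_pos_def by (simp add: sym_pos_def_def)
  have "LIM k sequentially. (a \<bullet> z i k)\<^sup>2 / (a \<bullet> (W k *v a)) :> at_top"
  proof (rule LIM_at_top_divide)
    show "(\<lambda>k. (a \<bullet> z i k)\<^sup>2) \<longlonglongrightarrow> (a \<bullet> z0 i)\<^sup>2" by (intro tendsto_intros z i)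
    show "0 < (a \<bullet> z0 i)\<^sup>2" using a by simp
    show "(\<lambda>k. a \<bullet> (W k *v a)) \<longlonglongrightarrow> 0" using tendsto_form[OF W, of a a] a by simp
  qed (simp add: pos)
  then show ?thesis
  proof (rule filterlim_at_top_mono)
    have "(a \<bullet> z i k)\<^sup>2 \<le> (a \<bullet> (W k *v a)) * s i k" for k
      using form_Cauchy_Schwarz[OF W_pos_def, of a k "matrix_inv (W k) *v z i k"]
      unfolding inner_z s_eq .
    then show "\<forall>\<^sub>F k in sequentially. (a \<bullet> z i k)\<^sup>2 / (a \<bullet> (W k *v a)) \<le> s i k"
      using pos by (simp add: divide_le_eq mult.commute)
  qed
qed

text \<open>Of the fixed total in \<open>sum_psi\<close>, the points with limit in
  \<open>rng\<close> take at least \<open>card I * dim rng\<close> up to an arbitrary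
  \<open>e\<close>. The rest must hold a contribution tending to \<open>psi_sup u\<close> from each
  point outside.\<close>

lemma card_outside_rng:
  "psi_sup u * real (card {i \<in> I. z0 i \<notin> rng})
    \<le> real (card I) * (real CARD('p) - real (dim rng))"
proof -
  define J where "J = {i \<in> I. z0 i \<in> rng}"
  have J: "J \<subseteq> I" by (auto simp: J_def)
  have IJ: "I - J = {i \<in> I. z0 i \<notin> rng}" by (auto simp: J_def)
  have top: "filterlim (s i) at_top sequentially" if "i \<in> I - J" for i
    using that s_at_top by (auto simp: IJ)
  have "(\<lambda>k. \<Sum>i\<in>I - J. psi u (s i k)) \<longlonglongrightarrow> (\<Sum>i\<in>I - J. psi_sup u)"
    by (intro tendsto_sum filterlim_compose[OF psi_tendsto_psi_sup[OF u]] top)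
  then have lim: "(\<lambda>k. \<Sum>i\<in>I - J. psi u (s i k)) \<longlonglongrightarrow> psi_sup u * real (card (I - J))"
    by (simp add: mult.commute)
  have "psi_sup u * real (card (I - J)) \<le> real (card I) * (real CARD('p) - real (dim rng)) + e"
    if e: "e > 0" for e
  proof (rule tendsto_upperbound[OF lim _ sequentially_bot])
    have "\<forall>\<^sub>F k in sequentially. real (card I) * real (dim rng) \<le> (\<Sum>i\<in>J. psi u (s i k)) + e"
      by (rule dim_le_sum_psi[OF subspace_rng W0_pos_on_rng J _ e]) (use top in auto)
    then show "\<forall>\<^sub>F k in sequentially. (\<Sum>i\<in>I - J. psi u (s i k))
        \<le> real (card I) * (real CARD('p) - real (dim rng)) + e"
    proof eventually_elim
      case (elim k)
      then show ?case
        using sum_psi[of k] sum.subset_diff[OF J finite_I, of "\<lambda>i. psi u (s i k)"]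
        by (simp add: right_diff_distrib)
    qed
  qed
  then show ?thesis unfolding IJ by (rule field_le_epsilon)
qed

end

subsection \<open>Points in general position\<close>

text \<open>If \<open>dim L + 1\<close> of the vectors lay in \<open>L\<close>, extending them to
  \<open>CARD('p)\<close> vectors would add only \<open>CARD('p) - dim L - 1\<close> more, too few
  to span the space together with \<open>L\<close>.\<close>

lemma general_position_card_le_dim:
  fixes x :: "nat \<Rightarrow> real^'p"
  assumes gen: "general_position t (collection n x)" and n: "CARD('p) \<le> n"
    and L: "subspace L" "dim L < CARD('p)"
  shows "card {i\<in>{1..n}. x i - t \<in> L} \<le> dim L"
proof (rule ccontr)
  assume "\<not> ?thesis"
  then have "Suc (dim L) \<le> card {i\<in>{1..n}. x i - t \<in> L}" by simp
  then obtain A1 where A1: "A1 \<subseteq> {i\<in>{1..n}. x i - t \<in> L}" "card A1 = Suc (dim L)"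
    using obtain_subset_with_card_n[of "Suc (dim L)" "{i\<in>{1..n}. x i - t \<in> L}"] by blast
  then have A1n: "A1 \<subseteq> {1..n}" by blast
  obtain A where A: "A1 \<subseteq> A" "A \<subseteq> {1..n}" "card A = CARD('p)"
    using exists_subset_between[of A1 "CARD('p)" "{1..n}"] A1n A1(2) L(2) n by auto
  have fin: "finite A" using A(2) finite_subset by blast
  define F where "F = (\<lambda>i. x i - t) ` (A - A1)"
  \<comment> \<open>Choosing indices rather than points keeps the submultiset at the right size even
    if points coincide.\<close>
  have "image_mset x (mset_set A) \<subseteq># collection n x"
    unfolding collection_def using A(2) by (intro image_mset_subseteq_mono subset_imp_msubset_mset_set) auto
  moreover have "size (image_mset x (mset_set A)) = CARD('p)" using A(3) by simp
  ultimately have "span ((\<lambda>y. y - t) ` set_mset (image_mset x (mset_set A))) = (UNIV :: (real^'p) set)"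
    using gen unfolding general_position_def by blast
  then have spanA: "span ((\<lambda>y. y - t) ` x ` A) = (UNIV :: (real^'p) set)"
    using fin by simp
  obtain B where B: "B \<subseteq> L" "independent B" "L \<subseteq> span B" "card B = dim L"
    using basis_exists by blast
  have "(\<lambda>y. y - t) ` x ` A \<subseteq> span (B \<union> F)"
  proof
    fix v assume "v \<in> (\<lambda>y. y - t) ` x ` A"
    then obtain i where i: "i \<in> A" "v = x i - t" by blast
    show "v \<in> span (B \<union> F)"
    proof (cases "i \<in> A1")
      case True
      then have "v \<in> span B" using A1(1) B(3) i by blast
      then show ?thesis by (meson in_mono span_mono sup_ge1)
    next
      case False
      then show ?thesis using i by (intro span_base) (auto simp: F_def)
    qed
  qed
  then have "(UNIV :: (real^'p) set) \<subseteq> span (B \<union> F)"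
    using span_minimal[OF _ subspace_span] unfolding spanA[symmetric] by blast
  then have "dim (UNIV :: (real^'p) set) \<le> card (B \<union> F)"
    using B(2) fin by (intro dim_le_card) (auto simp: F_def independent_imp_finite)
  also have "\<dots> \<le> card B + card F" by (rule card_Un_le)
  also have "card F \<le> card (A - A1)" unfolding F_def using fin by (intro card_image_le) auto
  also have "card (A - A1) = CARD('p) - Suc (dim L)"
    using A A1(2) fin by (simp add: card_Diff_subset finite_subset)
  finally show False using B(4) L(2) by simp
qed

text \<open>Here \<open>y\<close> holds the centred points, \<open>card_le\<close> is general
  position, and \<open>lower\<close> and \<open>upper\<close> are the bounds on the contamination
  fraction with denominators cleared. The range is found by excluding full rank, then placing
  \<open>y 1\<close> in it, then excluding rank 2 or more.\<close>

lemma scatter_limit_rank_one: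
  fixes y :: "nat \<Rightarrow> real^'p"
  assumes sl: "scatter_limit u {1..n+m} z z0 W W0"
    and z0: "\<And>i. i \<in> {1..n} \<Longrightarrow> z0 i = y i" "\<And>i. i \<in> {n<..n+m} \<Longrightarrow> z0 i = y 1"
    and card_le: "\<And>L. subspace L \<Longrightarrow> dim L < CARD('p) \<Longrightarrow> card {i\<in>{1..n}. y i \<in> L} \<le> dim L"
    and p: "2 \<le> CARD('p)" "CARD('p) < n"
    and lower: "psi_sup u * (real n - 1) < (real CARD('p) - 1) * real (n + m)"
    and upper: "(real CARD('p) - 2) * real (n + m) < psi_sup u * (real n - 2)"
  shows "0 < y 1 \<bullet> (W0 *v y 1)" and "a \<bullet> y 1 = 0 \<Longrightarrow> a \<bullet> (W0 *v a) = 0"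
proof -
  interpret scatter_limit u "{1..n+m}" z z0 W W0 by (fact sl)
  define K where "K = psi_sup u"
  define r where "r = dim rng"
  define P where "P = real CARD('p)"
  have Kp: "P < K" using u by (simp add: K_def P_def weight_conditions_def)
  have p': "2 \<le> P" "P < real n" using p by (auto simp: P_def)
  have K0: "0 < K" using Kp p' by linarith
  have y1: "y 1 \<noteq> 0"
  proof
    assume "y 1 = 0"
    then have "1 \<in> {i\<in>{1..n}. y i \<in> {0}}" using p by simp
    moreover have "card {i\<in>{1..n}. y i \<in> {0}} \<le> 0"
      using card_le[of "{0}"] p by simp
    then have "{i\<in>{1..n}. y i \<in> {0}} = {}" by simp
    ultimately show False by blast
  qed
  have r_le: "r \<le> CARD('p)" using dim_subset_UNIV[of rng] by (simp add: r_def)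
  have "r \<noteq> CARD('p)"
  proof
    assume "r = CARD('p)"
    then have full: "rng = UNIV" using subspace_rng dim_eq_full[of rng]
      by (simp add: r_def span_eq_iff[THEN iffD2])
    \<comment> \<open>On this hyperplane the contaminating points and the first point have limits
      orthogonal to \<open>S\<close>, so only the indices in \<open>{2..n}\<close> can
      count.\<close>
    define S where "S = {v. y 1 \<bullet> v = 0}"
    have "subspace S" by (simp add: S_def subspace_hyperplane)
    moreover have "dim S = CARD('p) - 1" using dim_hyperplane[OF y1] by (simp add: S_def)
    ultimately have off: "real (n + m) * (P - 1)
        \<le> K * real (card {i \<in> {1..n+m}. \<exists>v\<in>S. v \<bullet> z0 i \<noteq> 0})"
      using dim_le_card_off[of S] W0_pos_on_rng full p by (simp add: K_def P_def of_nat_diff)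
    have "{i \<in> {1..n+m}. \<exists>v\<in>S. v \<bullet> z0 i \<noteq> 0} \<subseteq> {2..n}"
    proof
      fix i assume i: "i \<in> {i \<in> {1..n+m}. \<exists>v\<in>S. v \<bullet> z0 i \<noteq> 0}"
      then have "z0 i \<noteq> y 1" by (auto simp: S_def inner_commute)
      then have "i \<noteq> 1" "\<not> n < i" using z0(1)[of 1] z0(2)[of i] i p by auto
      then show "i \<in> {2..n}" using i by auto
    qed
    then have "card {i \<in> {1..n+m}. \<exists>v\<in>S. v \<bullet> z0 i \<noteq> 0} \<le> n - 1"
      using card_mono[of "{2..n}" "{i \<in> {1..n+m}. \<exists>v\<in>S. v \<bullet> z0 i \<noteq> 0}"] by simp
    then have "K * real (card {i \<in> {1..n+m}. \<exists>v\<in>S. v \<bullet> z0 i \<noteq> 0}) \<le> K * (real n - 1)"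
      using K0 p by (intro mult_left_mono) (auto simp: of_nat_diff)
    with off show False using lower by (simp add: K_def P_def mult.commute)
  qed
  then have r_less: "r < CARD('p)" using r_le by simp
  have inX: "card {i\<in>{1..n}. y i \<in> rng} \<le> r"
    unfolding r_def using r_less by (intro card_le subspace_rng) (simp add: r_def)
  have outside: "K * real (card {i \<in> {1..n+m}. z0 i \<notin> rng}) \<le> real (n + m) * (P - real r)"
    using card_outside_rng by (simp add: K_def P_def r_def)
  have split: "card {i \<in> {1..n+m}. z0 i \<notin> rng} + card {i \<in> {1..n+m}. z0 i \<in> rng} = n + m"
  proof -
    have "{i \<in> {1..n+m}. z0 i \<notin> rng} \<union> {i \<in> {1..n+m}. z0 i \<in> rng} = {1..n+m}" by blast
    then show ?thesis
      using card_Un_disjoint[of "{i \<in> {1..n+m}. z0 i \<notin> rng}" "{i \<in> {1..n+m}. z0 i \<in> rng}"]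
      by (simp add: disjoint_iff)
  qed
  \<comment> \<open>Otherwise all contaminating points also end outside, leaving at most
    \<open>r\<close> points inside. With \<open>N = n + m\<close> this gives
    \<open>K * (N - r) \<le> N * (P - r)\<close>, and \<open>K > P\<close> then yields
    \<open>N * r < P * r\<close>, impossible since \<open>P < N\<close>.\<close>
  have y1_rng: "y 1 \<in> rng"
  proof (rule ccontr)
    assume "y 1 \<notin> rng"
    then have "i \<in> {1..n} \<and> y i \<in> rng" if "i \<in> {1..n+m}" "z0 i \<in> rng" for i
      using that z0(1)[of i] z0(2)[of i] by (cases "i \<le> n") auto
    then have "{i \<in> {1..n+m}. z0 i \<in> rng} \<subseteq> {i\<in>{1..n}. y i \<in> rng}" by blast
    then have "card {i \<in> {1..n+m}. z0 i \<in> rng} \<le> r"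
      using inX card_mono[of "{i\<in>{1..n}. y i \<in> rng}" "{i \<in> {1..n+m}. z0 i \<in> rng}"] by simp
    then have "real (n + m) - real r \<le> real (card {i \<in> {1..n+m}. z0 i \<notin> rng})"
      using split by linarith
    then have "K * (real (n + m) - real r) \<le> real (n + m) * (P - real r)"
      using outside K0 by (meson mult_left_mono less_imp_le order_trans)
    moreover have "P * (real (n + m) - real r) < K * (real (n + m) - real r)"
      using Kp r_less p by (intro mult_strict_right_mono) auto
    ultimately have "real (n + m) * real r < P * real r" by (simp add: algebra_simps)
    moreover have "P * real r \<le> real (n + m) * real r"
      using p' by (intro mult_right_mono) auto
    ultimately show False by linarith
  qed
  \<comment> \<open>For \<open>r \<ge> 2\<close> at most \<open>r + m\<close> points lie inside.
    Eliminating \<open>K\<close> between the resulting inequality and \<open>upper\<close> leaves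
    \<open>(r - 2) * (n - P) < 0\<close>.\<close>
  have "r = 1"
  proof (rule ccontr)
    assume "r \<noteq> 1"
    moreover have "r \<noteq> 0" using y1 y1_rng by (auto simp: r_def dim_eq_0)
    ultimately have r2: "2 \<le> r" by simp
    have "{i \<in> {1..n+m}. z0 i \<in> rng} \<subseteq> {i\<in>{1..n}. y i \<in> rng} \<union> {n<..n+m}"
      using z0(1) by auto
    then have "card {i \<in> {1..n+m}. z0 i \<in> rng} \<le> card ({i\<in>{1..n}. y i \<in> rng} \<union> {n<..n+m})"
      by (intro card_mono) auto
    also have "\<dots> \<le> r + m"
      using card_Un_le[of "{i\<in>{1..n}. y i \<in> rng}" "{n<..n+m}"] inX by simp
    finally have "real n - real r \<le> real (card {i \<in> {1..n+m}. z0 i \<notin> rng})"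
      using split by linarith
    then have "K * (real n - real r) \<le> real (n + m) * (P - real r)"
      using outside K0 by (meson mult_left_mono less_imp_le order_trans)
    then have "K * (real n - real r) * (real n - 2) \<le> real (n + m) * (P - real r) * (real n - 2)"
      using p' by (intro mult_right_mono) auto
    moreover have "(P - 2) * real (n + m) * (real n - real r)
        < K * (real n - 2) * (real n - real r)"
      using upper r_less p by (intro mult_strict_right_mono) (auto simp: K_def P_def)
    ultimately have "real (n + m) * ((P - 2) * (real n - real r))
        < real (n + m) * ((P - real r) * (real n - 2))"
      by (simp add: mult_ac)
    then have "(P - 2) * (real n - real r) < (P - real r) * (real n - 2)"
      by (rule mult_less_cancel_left_pos[THEN iffD1, rotated]) (use p in auto)
    then have "(real r - 2) * (real n - P) < 0" by (simp add: algebra_simps)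
    moreover have "0 \<le> (real r - 2) * (real n - P)" using r2 p' by (intro mult_nonneg_nonneg) auto
    ultimately show False by linarith
  qed
  moreover have "span {y 1} \<subseteq> rng" using y1_rng subspace_rng by (simp add: span_minimal)
  moreover have "dim (span {y 1}) = 1" using y1 by simp
  ultimately have rng: "rng = span {y 1}"
    using subspace_dim_equal[of "span {y 1}" rng] subspace_rng by (simp add: r_def)
  show "0 < y 1 \<bullet> (W0 *v y 1)" by (rule W0_pos_on_rng[OF y1_rng y1])
  \<comment> \<open>\<open>W0 *v a\<close> lies on the line through \<open>y 1\<close>, to which
    \<open>a\<close> is orthogonal.\<close>
  show "a \<bullet> (W0 *v a) = 0" if a: "a \<bullet> y 1 = 0"
    using W0_in_rng[of a] a unfolding rng by (auto simp: span_singleton)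
qed

subsection \<open>The contaminated samples\<close>

lemma sum_collection_Un:
  "(\<Sum>v\<in>#collection n x + collection m y. f v)
    = (\<Sum>i=1..n+m. f (if i \<le> n then x i else y (i - n)))"
proof -
  have "(\<Sum>v\<in>#collection n x + collection m y. f v) = (\<Sum>i=1..n. f (x i)) + (\<Sum>i=1..m. f (y i))"
    by (simp add: collection_def sum_unfold_sum_mset multiset.map_comp comp_def)
  also have "(\<Sum>i=1..m. f (y i)) = (\<Sum>i=n+1..n+m. f (y (i - n)))"
    using sum.shift_bounds_cl_nat_ivl[of "\<lambda>i. f (y (i - n))" 1 n m] by (simp add: add.commute)
  also have "(\<Sum>i=1..n. f (x i)) + \<dots> = (\<Sum>i=1..n+m. f (if i \<le> n then x i else y (i - n)))"
    by (subst sum.ub_add_nat) (auto intro!: arg_cong2[of _ _ _ _ "(+)"] sum.cong)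
  finally show ?thesis .
qed

text \<open>The weights are bounded and the convergent points have bounded outer products, so the
  estimates stay in a compact ball. The start index \<open>k0\<close> is there because nothing is
  known about \<open>V 0\<close> in the application.\<close>

lemma M_scatter_norm_le:
  fixes z :: "'i \<Rightarrow> nat \<Rightarrow> real^'p" and V :: "nat \<Rightarrow> real^'p^'p"
  assumes u: "bounded (u ` {0..})" and V: "\<And>k. k \<ge> k0 \<Longrightarrow> sym_pos_def (V k)"
    and z: "\<And>i. i \<in> I \<Longrightarrow> z i \<longlonglongrightarrow> z0 i"
    and V_eq: "\<And>k. k \<ge> k0 \<Longrightarrow> V k = c *\<^sub>R
      (\<Sum>i\<in>I. u (z i k \<bullet> (matrix_inv (V k) *v z i k)) *\<^sub>R outer (z i k))"
  obtains D where "\<And>k. k \<ge> k0 \<Longrightarrow> norm (V k) \<le> D"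
proof -
  obtain C where C: "\<And>s. 0 \<le> s \<Longrightarrow> \<bar>u s\<bar> \<le> C"
    using u unfolding bounded_iff by auto
  have "\<exists>D. \<forall>k. norm (outer (z i k)) \<le> D" if "i \<in> I" for i
  proof -
    have "(\<lambda>k. outer (z i k)) \<longlonglongrightarrow> outer (z0 i)"
      unfolding outer_def by (intro tendsto_intros z that)
    then show ?thesis by (metis Bseq_def convergentI convergent_imp_Bseq)
  qed
  then obtain D where D: "\<And>i k. i \<in> I \<Longrightarrow> norm (outer (z i k)) \<le> D i" by metis
  show thesis
  proof (rule that)
    fix k assume k: "k \<ge> k0"
    have "norm (\<Sum>i\<in>I. u (z i k \<bullet> (matrix_inv (V k) *v z i k)) *\<^sub>R outer (z i k)) \<le> (\<Sum>i\<in>I. C * D i)"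
    proof (rule sum_norm_le)
      fix i assume i: "i \<in> I"
      have "0 \<le> z i k \<bullet> (matrix_inv (V k) *v z i k)"
        using sym_pos_def_nonneg[OF V[OF k], of "matrix_inv (V k) *v z i k"]
        unfolding sym_pos_def_cancel_inv[OF V[OF k]] by (simp add: inner_commute)
      from C[OF this] D[OF i, of k]
      show "norm (u (z i k \<bullet> (matrix_inv (V k) *v z i k)) *\<^sub>R outer (z i k)) \<le> C * D i"
        unfolding norm_scaleR by (intro mult_mono) auto
    qed
    then show "norm (V k) \<le> \<bar>c\<bar> * (\<Sum>i\<in>I. C * D i)"
      by (subst V_eq[OF k]) (simp add: mult_left_mono)
  qed
qed

theorem theorem5p2:
  fixes t :: "real^'p" and u :: "real \<Rightarrow> real"
    and x :: "nat \<Rightarrow> real^'p" and w :: "nat \<Rightarrow> nat \<Rightarrow> real^'p"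
    and V :: "nat \<Rightarrow> real^'p^'p"
    and n m :: nat and \<epsilon> K :: real
  assumes u: "weight_conditions CARD('p) u"
    and K: "K = psi_sup u"
    and gen: "general_position t (collection n x)"
    and n: "n > CARD('p) * (CARD('p) - 1)"
    and m: "m \<ge> 1"
    and eps: "\<epsilon> = real m / real (n + m)"
    and w: "\<And>i. i \<in> {1..m} \<Longrightarrow> (\<lambda>k. w i k) \<longlonglongrightarrow> 0"
    and V: "\<And>k. k \<ge> 1 \<Longrightarrow>
              is_M_scatter u t (collection n x + collection m (\<lambda>i. x 1 + w i k)) (V k)"
    and lower: "1 - real n * (real CARD('p) - 1) / (K * (real n - 1)) < \<epsilon>"
    and upper: "\<epsilon> < 1 - real n * (real CARD('p) - 2) / (K * (real n - 2))"
  shows "(INF k\<in>{1..}. (x 1 - t) \<bullet> (V k *v (x 1 - t))) > 0 \<and>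
         (\<forall>a. a \<bullet> (x 1 - t) = 0 \<longrightarrow> (\<lambda>k. a \<bullet> (V k *v a)) \<longlonglongrightarrow> 0)"
proof -
  define y where "y i = x i - t" for i
  define z where "z i k = (if i \<le> n then y i else y 1 + w (i - n) k)" for i k
  define z0 where "z0 i = (if i \<le> n then y i else y 1)" for i
  define q where "q k = y 1 \<bullet> (V k *v y 1)" for k
  have eps1: "1 - \<epsilon> = real n / real (n + m)" using eps m by (simp add: field_simps)
  \<comment> \<open>In dimension one the lower bound reads \<open>1 < \<epsilon>\<close>, while a
    fraction is at most 1.\<close>
  have p2: "2 \<le> CARD('p)"
  proof (rule ccontr)
    assume "\<not> ?thesis"
    moreover have "CARD('p) \<noteq> 0" by simp
    ultimately have "CARD('p) = 1" by linarith
    then have "1 - \<epsilon> < 0" using lower by simp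
    moreover have "0 \<le> 1 - \<epsilon>" unfolding eps1 by simp
    ultimately show False by linarith
  qed
  have "CARD('p) * 1 \<le> CARD('p) * (CARD('p) - 1)" using p2 by (intro mult_le_mono2) simp
  \<comment> \<open>Together with \<open>p2\<close> this makes \<open>n\<close> at least 3, so both
    \<open>n - 1\<close> and \<open>n - 2\<close> are positive when denominators are
    cleared.\<close>
  then have pn: "CARD('p) < n" using n by linarith
  have K0: "0 < K" using u K by (simp add: weight_conditions_def)
  have lower': "psi_sup u * (real n - 1) < (real CARD('p) - 1) * real (n + m)"
  proof -
    have "real n / real (n + m) < real n * (real CARD('p) - 1) / (K * (real n - 1))"
      using lower eps1 by linarith
    then have "real n * (K * (real n - 1)) < real n * ((real CARD('p) - 1) * real (n + m))"
      using K0 pn p2 by (simp add: divide_less_eq less_divide_eq pos_divide_less_eq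
          pos_less_divide_eq mult_ac)
    then show ?thesis using K pn by (simp add: mult_less_cancel_left_pos)
  qed
  have upper': "(real CARD('p) - 2) * real (n + m) < psi_sup u * (real n - 2)"
  proof -
    have "real n * (real CARD('p) - 2) / (K * (real n - 2)) < real n / real (n + m)"
      using upper eps1 by linarith
    then have "real n * ((real CARD('p) - 2) * real (n + m)) < real n * (K * (real n - 2))"
      using K0 pn p2 by (simp add: divide_less_eq less_divide_eq pos_divide_less_eq
          pos_less_divide_eq mult_ac)
    then show ?thesis using K pn by (simp add: mult_less_cancel_left_pos)
  qed
  have z_lim: "z i \<longlonglongrightarrow> z0 i" if "i \<in> {1..n+m}" for i
  proof (cases "i \<le> n")
    case True
    then have "z i = (\<lambda>k. y i)" by (simp add: z_def fun_eq_iff)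
    then show ?thesis using True by (simp add: z0_def)
  next
    case False
    then have "i - n \<in> {1..m}" using that by auto
    from tendsto_add[OF tendsto_const w[OF this], of "y 1"]
    have "(\<lambda>k. y 1 + w (i - n) k) \<longlonglongrightarrow> y 1" by simp
    moreover have "z i = (\<lambda>k. y 1 + w (i - n) k)" using False by (simp add: z_def fun_eq_iff)
    ultimately show ?thesis using False by (simp add: z0_def)
  qed
  have pd: "sym_pos_def (V k)" if "k \<ge> 1" for k
    using V[OF that] by (simp add: is_M_scatter_def)
  have V_eq: "V k = (1 / real (card {1..n+m})) *\<^sub>R
      (\<Sum>i=1..n+m. u (z i k \<bullet> (matrix_inv (V k) *v z i k)) *\<^sub>R outer (z i k))" if k: "k \<ge> 1" for k
  proof -
    have "z i k = (if i \<le> n then x i else x 1 + w (i - n) k) - t" for i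
      by (simp add: z_def y_def algebra_simps)
    moreover have "size (collection n x + collection m (\<lambda>i. x 1 + w i k)) = card {1..n+m}"
      by (simp add: collection_def)
    ultimately show ?thesis
      using V[OF k] unfolding is_M_scatter_def sum_collection_Un sq_dist_def by simp
  qed
  have "bounded (u ` {0..})" using u by (simp add: weight_conditions_def)
  then obtain D where D: "\<And>k. k \<ge> 1 \<Longrightarrow> norm (V k) \<le> D"
    using M_scatter_norm_le[of u 1 V "{1..n+m}" z z0, OF _ pd z_lim V_eq] by blast
  \<comment> \<open>The condition on \<open>r\<close> keeps indices at least 1 and drives them to
    infinity without monotonicity, so indices chosen from a failing claim can be used
    directly.\<close>
  have limit: "\<exists>\<sigma> W0. strict_mono \<sigma> \<and> (\<lambda>j. V (r (\<sigma> j))) \<longlonglongrightarrow> W0 \<and>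
      0 < y 1 \<bullet> (W0 *v y 1) \<and> (\<forall>a. a \<bullet> y 1 = 0 \<longrightarrow> a \<bullet> (W0 *v a) = 0)"
    if r: "\<And>j. Suc j \<le> r j" for r
  proof -
    have r1: "1 \<le> r j" for j using r[of j] by simp
    have "\<forall>j. (V \<circ> r) j \<in> cball 0 D" using D r1 by simp
    then obtain W0 \<sigma> where \<sigma>: "strict_mono \<sigma>" "((V \<circ> r) \<circ> \<sigma>) \<longlonglongrightarrow> W0"
      using compact_cball[of 0 D] unfolding compact_def by metis
    have "j \<le> r (\<sigma> j)" for j
      using r[of "\<sigma> j"] seq_suble[OF \<sigma>(1), of j] by linarith
    then have top: "filterlim (\<lambda>j. r (\<sigma> j)) at_top sequentially"
      by (intro filterlim_at_top_mono[OF filterlim_ident] always_eventually allI)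
    have sl: "scatter_limit u {1..n+m} (\<lambda>i j. z i (r (\<sigma> j))) z0 (\<lambda>j. V (r (\<sigma> j))) W0"
    proof
      show "(\<lambda>j. z i (r (\<sigma> j))) \<longlonglongrightarrow> z0 i" if "i \<in> {1..n+m}" for i
        by (rule filterlim_compose[OF z_lim[OF that] top])
      show "V (r (\<sigma> j)) = (1 / real (card {1..n+m})) *\<^sub>R (\<Sum>i=1..n+m.
          u (z i (r (\<sigma> j)) \<bullet> (matrix_inv (V (r (\<sigma> j))) *v z i (r (\<sigma> j)))) *\<^sub>R outer (z i (r (\<sigma> j))))" for j
        by (rule V_eq[OF r1])
    qed (use u m pd[OF r1] \<sigma>(2) in \<open>simp_all add: comp_def\<close>)
    have gp: "card {i\<in>{1..n}. y i \<in> L} \<le> dim L" if "subspace L" "dim L < CARD('p)" for L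
      unfolding y_def using general_position_card_le_dim[OF gen _ that] pn by simp
    have z0_eq: "i \<in> {1..n} \<Longrightarrow> z0 i = y i" "i \<in> {n<..n+m} \<Longrightarrow> z0 i = y 1" for i
      by (simp_all add: z0_def)
    note rank_one = scatter_limit_rank_one[OF sl z0_eq gp p2 pn lower' upper']
    show ?thesis
      using \<sigma> rank_one by (auto simp: comp_def)
  qed
  \<comment> \<open>If this failed, indices with \<open>q (r j) < 1 / Suc j\<close> would produce a
    subsequential limit with form value at most 0 at \<open>y 1\<close>.\<close>
  have "\<exists>j. \<forall>k\<ge>Suc j. 1 / real (Suc j) \<le> q k"
  proof (rule ccontr)
    assume "\<not> ?thesis"
    then have "\<forall>j. \<exists>k\<ge>Suc j. q k < 1 / real (Suc j)" by (auto simp: not_le)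
    then obtain r where r: "\<And>j. Suc j \<le> r j" "\<And>j. q (r j) < 1 / real (Suc j)" by metis
    from limit[of r] r(1) obtain \<sigma> W0 where \<sigma>: "strict_mono \<sigma>" "(\<lambda>j. V (r (\<sigma> j))) \<longlonglongrightarrow> W0"
      "0 < y 1 \<bullet> (W0 *v y 1)" by blast
    have "(\<lambda>j. 1 / real (Suc (\<sigma> j))) \<longlonglongrightarrow> 0"
      using LIMSEQ_subseq_LIMSEQ[OF LIMSEQ_inverse_real_of_nat \<sigma>(1)]
      by (simp add: comp_def inverse_eq_divide)
    from LIMSEQ_le[OF tendsto_form[OF \<sigma>(2), of "y 1" "y 1"] this]
    have "y 1 \<bullet> (W0 *v y 1) \<le> 0" using r(2) by (auto simp: q_def intro: less_imp_le)
    then show False using \<sigma>(3) by simp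
  qed
  then obtain j where j: "\<And>k. Suc j \<le> k \<Longrightarrow> 1 / real (Suc j) \<le> q k" by blast
  have y1: "y 1 \<noteq> 0" using limit[of Suc] by auto
  \<comment> \<open>The tail bound combined with the finitely many earlier values, each positive by
    definiteness, bounds the infimum over all \<open>k \<ge> 1\<close>.\<close>
  define c where "c = Min (insert (1 / real (Suc j)) (q ` {1..j}))"
  have "q k > 0" if "k \<ge> 1" for k
    using pd[OF that] y1 by (simp add: q_def sym_pos_def_def)
  then have "c > 0" by (simp add: c_def)
  have c_le: "c \<le> q k" if "k \<ge> 1" for k
  proof (cases "k \<le> j")
    case True
    then show ?thesis unfolding c_def using that by (intro Min_le) auto
  next
    case False
    then have "1 / real (Suc j) \<le> q k" by (intro j) simp
    moreover have "c \<le> 1 / real (Suc j)" unfolding c_def by (intro Min_le) auto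
    ultimately show ?thesis by linarith
  qed
  have "c \<le> (INF k\<in>{1..}. q k)" by (rule cINF_greatest) (auto intro: c_le)
  with \<open>c > 0\<close> have inf: "(INF k\<in>{1..}. q k) > 0" by linarith
  \<comment> \<open>Failure of convergence gives indices where the form stays at least
    \<open>e\<close> in absolute value, yet a further subsequence tends to 0.\<close>
  have null: "(\<lambda>k. a \<bullet> (V k *v a)) \<longlonglongrightarrow> 0" if a: "a \<bullet> y 1 = 0" for a
  proof (rule ccontr)
    assume "\<not> ?thesis"
    then obtain e where e: "e > 0" "\<And>N. \<exists>k\<ge>N. e \<le> \<bar>a \<bullet> (V k *v a)\<bar>"
      unfolding LIMSEQ_def dist_real_def by (auto simp: not_less)
    then have "\<forall>j. \<exists>k. Suc j \<le> k \<and> e \<le> \<bar>a \<bullet> (V k *v a)\<bar>" by blast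
    from choice[OF this] obtain r where r: "\<And>j. Suc j \<le> r j"
      "\<And>j. e \<le> \<bar>a \<bullet> (V (r j) *v a)\<bar>" by blast
    from limit[of r] r(1) a obtain \<sigma> W0 where \<sigma>: "(\<lambda>j. V (r (\<sigma> j))) \<longlonglongrightarrow> W0"
      "a \<bullet> (W0 *v a) = 0" by blast
    have "(\<lambda>j. \<bar>a \<bullet> (V (r (\<sigma> j)) *v a)\<bar>) \<longlonglongrightarrow> 0"
      using tendsto_rabs[OF tendsto_form[OF \<sigma>(1), of a a]] \<sigma>(2) by simp
    then have "e \<le> 0" by (rule LIMSEQ_le_const) (use r(2) in blast)
    then show False using e(1) by simp
  qed
  show ?thesis using inf null by (simp add: q_def y_def)
qed

end
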